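(* Let $N\geq1$, let $A_N=\bigoplus_{j=1}^N(-jJ)\in\mathbb{R}^{2N\times2N}$, and for $b_N=(b_{N,1},\ldots,b_{N,N})\in\mathbb{R}^N$ with $\sum_{j=1}^Nb_{N,j}^2=1$ let $\widehat b_N=\bigoplus_{j=1}^N(0,b_{N,j})^\top\in\mathbb{R}^{2N}$. For $T=2\pi M$ with $M\in\mathbb{N}^*$, $$\max_{\sum_jb_{N,j}^2=1}\lambda_{\min}(G_T(A_N,\widehat b_N))=\frac{T}{2N}.$$ The maximizing profiles are exactly those satisfying $b_{N,j}^2=\frac1N$ for every $j\in\{1,\ldots,N\}$ (their squared coefficients are unique, but their $N$ signs are arbitrary). They attain the unrestricted covariance relaxation in dimension $2N$, i.e. $\frac{T}{2N}=\gamma_{\mathrm{rel}}(A_N,T)$. After multiplication by $\sqrt N$ their modal moduli are constant, and the corresponding formal infinite profiles $b=\sum_{j\geq1}b_j\varphi_j$ with $\vert b_j\vert=1$ for all $j$ belong to $H_D^{-s}$ if and only if $s>1/2$.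
   Context: $J=\begin{pmatrix}0&-1\\1&0\end{pmatrix}$; $\bigoplus$ denotes block-diagonal matrices (respectively concatenation of vectors of $\mathbb{R}^2$). $G_T(A,b)=\int_0^Te^{tA}bb^\top e^{tA^\top}\,dt$, and $\gamma_{\mathrm{rel}}(A,T)=\max_{X\succeq0,\ \operatorname{tr}X=1}\lambda_{\min}\big(\int_0^Te^{tA}Xe^{tA^\top}dt\big)$ over real symmetric $X$ of the size of $A$. (The system $\dot z=A_Nz+\widehat b_Nu$ is the truncation of the one-dimensional Dirichlet wave equation to its first $N$ modes in energy coordinates $z_j=(jy_j,\dot y_j)$, with force acting on the velocity.) $\mathbb{N}^*=\{1,2,\ldots\}$. $\varphi_j(x)=\sqrt{2/\pi}\sin(jx)$ on $(0,\pi)$; for a formal series $b=\sum_{j\geq1}b_j\varphi_j$ and $s\in\mathbb{R}$, $b\in H_D^{-s}$ means $\sum_{j\geq1}j^{-2s}\vert b_j\vert^2<+\infty$. *)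

theory Defs
  imports "HOL-Analysis.Analysis" "Jordan_Normal_Form.Spectral_Radius"
begin

hide_type (open) Finite_Cartesian_Product.vec
hide_const (open) Finite_Cartesian_Product.vec Finite_Cartesian_Product.mat
  Finite_Cartesian_Product.transpose Determinants.trace
  Finite_Cartesian_Product.row Finite_Cartesian_Product.column Determinants.det
unbundle no vec_syntax
unbundle no inner_syntax

text \<open>
  Matrices and vectors are those of Jordan Normal Form, so that the size may depend on \<open>N\<close>;
  their entries are indexed from 0. Modes are indexed from 1: the coefficient of mode \<open>j\<close> of a
  profile \<open>b \<in> \<real>\<^sup>N\<close> is \<open>b $ (j - 1)\<close>.
\<close>

definition is_maximum :: "real set \<Rightarrow> real \<Rightarrow> bool" where
  "is_maximum S m \<longleftrightarrow> m \<in> S \<and> (\<forall>x\<in>S. x \<le> m)"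

definition mat_exp :: "real mat \<Rightarrow> real mat" where
  "mat_exp A = mat (dim_row A) (dim_row A) (\<lambda>(i, j). \<Sum>k. (A ^\<^sub>m k) $$ (i, j) / fact k)"

definition mat_trace :: "real mat \<Rightarrow> real" where
  "mat_trace A = (\<Sum>i<dim_row A. A $$ (i, i))"

definition pos_semidef :: "real mat \<Rightarrow> bool" where
  "pos_semidef X \<longleftrightarrow> square_mat X \<and> X\<^sup>T = X \<and> (\<forall>v \<in> carrier_vec (dim_row X). 0 \<le> v \<bullet> (X *\<^sub>v v))"

text \<open>
  Smallest real eigenvalue. It is only used for real symmetric matrices of positive size, whose
  spectrum over the reals is finite and nonempty.
\<close>
definition lambda_min :: "real mat \<Rightarrow> real" where
  "lambda_min A = Min (spectrum A)"

text \<open>\<open>\<integral>\<^sub>0\<^sup>T exp(tA) X exp(tA\<^sup>T) dt\<close>, integrated entrywise.\<close>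
definition cov_integral :: "real mat \<Rightarrow> real \<Rightarrow> real mat \<Rightarrow> real mat" where
  "cov_integral A T X = mat (dim_row A) (dim_row A)
     (\<lambda>ij. integral {0..T} (\<lambda>t. (mat_exp (t \<cdot>\<^sub>m A) * X * mat_exp (t \<cdot>\<^sub>m A\<^sup>T)) $$ ij))"

definition outer_square :: "real vec \<Rightarrow> real mat" where
  "outer_square b = mat (dim_vec b) (dim_vec b) (\<lambda>(i, j). b $ i * b $ j)"

definition gramian :: "real \<Rightarrow> real mat \<Rightarrow> real vec \<Rightarrow> real mat" where
  "gramian T A b = cov_integral A T (outer_square b)"

definition relaxed_values :: "real mat \<Rightarrow> real \<Rightarrow> real set" where
  "relaxed_values A T = {lambda_min (cov_integral A T X) | X.
     X \<in> carrier_mat (dim_row A) (dim_row A) \<and> pos_semidef X \<and> mat_trace X = 1}"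

definition gamma_rel :: "real mat \<Rightarrow> real \<Rightarrow> real" where
  "gamma_rel A T = (GREATEST r. r \<in> relaxed_values A T)"

definition J_mat :: "real mat" where
  "J_mat = mat_of_rows_list 2 [[0, -1], [1, 0]]"

definition wave_mat :: "nat \<Rightarrow> real mat" where
  "wave_mat N = diag_block_mat (map (\<lambda>j. - (real j \<cdot>\<^sub>m J_mat)) [1..<N + 1])"

definition unit_profiles :: "nat \<Rightarrow> real vec set" where
  "unit_profiles N = {b \<in> carrier_vec N. (\<Sum>j = 1..N. (b $ (j - 1))\<^sup>2) = 1}"

definition wave_input :: "nat \<Rightarrow> real vec \<Rightarrow> real vec" where
  "wave_input N b = vec_of_list (concat (map (\<lambda>j. [0, b $ (j - 1)]) [1..<N + 1]))"

definition wave_lambda :: "nat \<Rightarrow> real \<Rightarrow> real vec \<Rightarrow> real" where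
  "wave_lambda N T b = lambda_min (gramian T (wave_mat N) (wave_input N b))"

definition maximizing_profiles :: "nat \<Rightarrow> real \<Rightarrow> real vec set" where
  "maximizing_profiles N T = {b. is_arg_max (wave_lambda N T) (\<lambda>b. b \<in> unit_profiles N) b}"

text \<open>
  \<open>H\<^sub>D\<^bsup>-s\<^esup>\<close> as a set of formal series \<open>\<Sum>j\<ge>1. b j \<cdot> \<phi>\<^sub>j\<close> in the Dirichlet sine basis
  \<open>\<phi>\<^sub>j(x) = sqrt(2/pi) sin(jx)\<close>. A formal series is identified with its coefficient sequence;
  the value \<open>b 0\<close> plays no role.
\<close>
definition H_D_neg :: "real \<Rightarrow> (nat \<Rightarrow> real) set" where
  "H_D_neg s = {b. (\<lambda>j. real j powr (- 2 * s) * \<bar>b j\<bar>\<^sup>2) summable_on {1..}}"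

end

theory Submission
  imports Defs
begin

text \<open>
  Since \<open>exp(tA)\<close> is orthogonal, \<open>\<integral>\<^sub>0\<^sup>T exp(tA) X exp(tA)\<^sup>T dt\<close> has trace \<open>T tr X = T\<close>, and the
  smallest of its \<open>2N\<close> real eigenvalues is at most the mean \<open>T / (2N)\<close>; the choice \<open>X = I / (2N)\<close>
  attains this. Over full periods the trigonometric products integrate to 0 off the diagonal, so the
  Gramian of a profile \<open>b\<close> is the diagonal matrix with each \<open>T b\<^sub>j\<^sup>2 / 2\<close> repeated twice. As the
  \<open>b\<^sub>j\<^sup>2\<close> have mean \<open>1 / N\<close>, their minimum reaches \<open>1 / N\<close> exactly when they all agree.
\<close>

section \<open>The smallest eigenvalue and the trace\<close>

text \<open>The Hermitian form \<open>S\<close> of an eigenvector equals its own conjugate by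
  symmetry of \<open>W\<close>, and it also equals \<open>e\<close> times the positive squared norm
  of the eigenvector. This brings complex eigenvalues, which are available with multiplicity, back
  to the real spectrum used by \<open>lambda_min\<close>.\<close>

lemma real_symmetric_eigenvalue_real:
  assumes W: "W \<in> carrier_mat n n" and sym: "W\<^sup>T = W"
    and ev: "eigenvalue (map_mat complex_of_real W) e"
  shows "e \<in> \<real>"
proof -
  let ?B = "map_mat complex_of_real W"
  obtain v where v: "v \<in> carrier_vec n" "v \<noteq> 0\<^sub>v n" "?B *\<^sub>v v = e \<cdot>\<^sub>v v"
    using ev W unfolding eigenvalue_def eigenvector_def by auto
  have W_sym: "W $$ (i, j) = W $$ (j, i)" if "i < n" "j < n" for i j
    using arg_cong[OF sym, of "\<lambda>A. A $$ (i, j)"] that W by simp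
  define S where "S = (\<Sum>i<n. \<Sum>j<n. of_real (W $$ (i, j)) * v $ j * cnj (v $ i))"
  have "cnj S = (\<Sum>i<n. \<Sum>j<n. of_real (W $$ (i, j)) * cnj (v $ j) * v $ i)"
    unfolding S_def by simp
  also have "\<dots> = S"
    \<comment> \<open>Conjugation exchanges the roles of \<open>i\<close> and \<open>j\<close>;
      swapping the sums undoes this because \<open>W\<close> is symmetric.\<close>
    unfolding S_def by (subst sum.swap, intro sum.cong refl) (simp add: W_sym mult_ac)
  finally have S_real: "cnj S = S" .
  have row: "(\<Sum>j<n. of_real (W $$ (i, j)) * v $ j) = e * v $ i" if "i < n" for i
    using arg_cong[OF v(3), of "\<lambda>x. x $ i"] that W v(1)
    by (simp add: mult_mat_vec_def scalar_prod_def lessThan_atLeast0)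
  have "S = (\<Sum>i<n. e * v $ i * cnj (v $ i))"
    unfolding S_def by (intro sum.cong refl) (simp add: row flip: sum_distrib_right)
  also have "\<dots> = e * of_real (\<Sum>i<n. (cmod (v $ i))\<^sup>2)"
    by (simp add: sum_distrib_left complex_norm_square mult_ac del: of_real_power)
  finally have S_eq: "S = e * of_real (\<Sum>i<n. (cmod (v $ i))\<^sup>2)" .
  obtain i where i: "i < n" "v $ i \<noteq> 0"
    using v(1,2) by (metis carrier_vecD eq_vecI index_zero_vec)
  have "(\<Sum>i<n. (cmod (v $ i))\<^sup>2) > 0"
    using i by (intro sum_pos2[where i = i]) auto
  moreover have "cnj e * of_real (\<Sum>i<n. (cmod (v $ i))\<^sup>2) = e * of_real (\<Sum>i<n. (cmod (v $ i))\<^sup>2)"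
    using S_real unfolding S_eq by simp
  ultimately have "cnj e = e"
    by (metis less_irrefl mult_right_cancel of_real_eq_0_iff)
  thus ?thesis by (simp add: Reals_cnj_iff)
qed

lemma trace_mult_commute:
  fixes A B :: "'a :: comm_semiring_0 mat"
  assumes "A \<in> carrier_mat n m" "B \<in> carrier_mat m n"
  shows "(\<Sum>i<n. (A * B) $$ (i, i)) = (\<Sum>i<m. (B * A) $$ (i, i))"
proof -
  have "(\<Sum>i<n. (A * B) $$ (i, i)) = (\<Sum>i<n. \<Sum>j<m. A $$ (i, j) * B $$ (j, i))"
    using assms by (intro sum.cong refl) (simp add: scalar_prod_def lessThan_atLeast0)
  also have "\<dots> = (\<Sum>j<m. \<Sum>i<n. B $$ (j, i) * A $$ (i, j))"
    by (subst sum.swap) (simp add: mult.commute)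
  also have "\<dots> = (\<Sum>i<m. (B * A) $$ (i, i))"
    using assms by (intro sum.cong refl) (simp add: scalar_prod_def lessThan_atLeast0)
  finally show ?thesis .
qed

text \<open>Over the complex numbers the characteristic polynomial splits, and Schur decomposition
  gives a similar matrix with the list \<open>es\<close> of its roots, with multiplicity, on the
  diagonal. Similarity preserves the trace.\<close>

lemma trace_eq_sum_eigenvalues:
  fixes A :: "complex mat"
  assumes A: "A \<in> carrier_mat n n"
  obtains es where "length es = n" "\<And>e. e \<in> set es \<Longrightarrow> eigenvalue A e"
    "(\<Sum>i<n. A $$ (i, i)) = sum_list es"
proof -
  obtain es where es: "char_poly A = (\<Prod>a\<leftarrow>es. [:- a, 1:])" "length es = n"
    using char_poly_factorized[OF A] by auto
  obtain B P Q where dec: "schur_decomposition A es = (B, P, Q)"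
    by (cases "schur_decomposition A es") auto
  have sim: "similar_mat_wit A B P Q" and diag: "diag_mat B = es"
    using schur_decomposition[OF A es(1) dec] by auto
  have PQ: "B \<in> carrier_mat n n" "P \<in> carrier_mat n n" "Q \<in> carrier_mat n n"
    "Q * P = 1\<^sub>m n" "A = P * B * Q"
    using similar_mat_witD2[OF A sim] by auto
  have "(\<Sum>i<n. A $$ (i, i)) = (\<Sum>i<n. (Q * (P * B)) $$ (i, i))"
    unfolding PQ(5) using PQ by (intro trace_mult_commute) auto
  also have "Q * (P * B) = B"
    using PQ by (simp flip: assoc_mult_mat)
  also have "(\<Sum>i<n. B $$ (i, i)) = sum_list es"
    using PQ(1) unfolding diag[symmetric] diag_mat_def
    by (simp add: sum_list_sum_nth lessThan_atLeast0)
  finally have tr: "(\<Sum>i<n. A $$ (i, i)) = sum_list es" .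
  have "eigenvalue A e" if "e \<in> set es" for e
    using that unfolding eigenvalue_root_char_poly[OF A] es(1)
    by (auto simp: poly_prod_list prod_list_zero_iff image_iff)
  thus ?thesis using that es(2) tr by blast
qed

text \<open>The trace is the sum of \<open>n\<close> eigenvalues counted with multiplicity, and each
  of them is at least \<open>lambda_min W\<close>.\<close>

lemma lambda_min_le_trace:
  assumes W: "W \<in> carrier_mat n n" and sym: "W\<^sup>T = W"
  shows "real n * lambda_min W \<le> mat_trace W"
proof -
  let ?B = "map_mat complex_of_real W"
  have B: "?B \<in> carrier_mat n n" using W by simp
  obtain es where es: "length es = n" "\<And>e. e \<in> set es \<Longrightarrow> eigenvalue ?B e"
    "(\<Sum>i<n. ?B $$ (i, i)) = sum_list es"
    using trace_eq_sum_eigenvalues[OF B] by blast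
  have le: "lambda_min W \<le> Re e" if e: "e \<in> set es" for e
  proof -
    have "e \<in> \<real>"
      using real_symmetric_eigenvalue_real[OF W sym es(2)[OF e]] .
    then obtain r where r: "e = of_real r" by (elim Reals_cases)
    \<comment> \<open>The real number \<open>r\<close> is an eigenvalue of the complexified matrix;
      its characteristic polynomial is the image of the real one, so \<open>r\<close> already lies
      in the real spectrum.\<close>
    have "poly (char_poly ?B) e = 0"
      using es(2)[OF e] eigenvalue_root_char_poly[OF B] by simp
    hence "poly (char_poly W) r = 0"
      unfolding of_real_hom.char_poly_hom[OF W] r by simp
    hence "r \<in> spectrum W"
      unfolding spectrum_def using eigenvalue_root_char_poly[OF W] by simp
    thus ?thesis
      unfolding lambda_min_def r using card_finite_spectrum(1)[OF W] by simp
  qed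
  have "real n * lambda_min W = (\<Sum>e\<leftarrow>es. lambda_min W)"
    by (simp add: sum_list_triv es(1))
  also have "\<dots> \<le> (\<Sum>e\<leftarrow>es. Re e)" by (intro sum_list_mono le)
  also have "\<dots> = Re (sum_list es)" by (induction es) auto
  also have "\<dots> = mat_trace W"
    using W unfolding es(3)[symmetric] mat_trace_def by simp
  finally show ?thesis .
qed

section \<open>Diagonal matrices and their spectra\<close>

lemma mult_diagonal_vec:
  fixes d :: "nat \<Rightarrow> 'a :: comm_semiring_1"
  assumes "v \<in> carrier_vec n"
  shows "mat n n (\<lambda>(i, j). if i = j then d i else 0) *\<^sub>v v = vec n (\<lambda>i. d i * v $ i)"
proof (intro eq_vecI)
  fix i assume "i < dim_vec (vec n (\<lambda>i. d i * v $ i))"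
  hence i: "i < n" by simp
  have "(mat n n (\<lambda>(i, j). if i = j then d i else 0) *\<^sub>v v) $ i
      = (\<Sum>k = 0..<n. (if i = k then d i else 0) * v $ k)"
    using i assms by (simp add: scalar_prod_def)
  also have "\<dots> = (\<Sum>k = 0..<n. if i = k then d i * v $ k else 0)"
    by (intro sum.cong) auto
  finally show "(mat n n (\<lambda>(i, j). if i = j then d i else 0) *\<^sub>v v) $ i
      = vec n (\<lambda>i. d i * v $ i) $ i"
    using i by simp
qed simp

text \<open>A nonzero entry of an eigenvector forces the eigenvalue to be the diagonal entry in that
  position; conversely, unit vectors are eigenvectors.\<close>

lemma spectrum_diagonal:
  fixes d :: "nat \<Rightarrow> 'a :: field"
  shows "spectrum (mat n n (\<lambda>(i, j). if i = j then d i else 0)) = d ` {..<n}"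
    (is "spectrum ?D = _")
proof (intro equalityI subsetI)
  fix e assume "e \<in> spectrum ?D"
  then obtain v where v: "v \<in> carrier_vec n" "v \<noteq> 0\<^sub>v n" "?D *\<^sub>v v = e \<cdot>\<^sub>v v"
    unfolding spectrum_def eigenvalue_def eigenvector_def by auto
  obtain i where i: "i < n" "v $ i \<noteq> 0"
    using v(1,2) by (metis carrier_vecD eq_vecI index_zero_vec)
  have "d i * v $ i = e * v $ i"
    using arg_cong[OF v(3), of "\<lambda>x. x $ i"] i v(1) by (simp add: mult_diagonal_vec)
  thus "e \<in> d ` {..<n}" using i by auto
next
  fix e assume "e \<in> d ` {..<n}"
  then obtain i where i: "i < n" "e = d i" by auto
  have "?D *\<^sub>v unit_vec n i = e \<cdot>\<^sub>v unit_vec n i"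
    using i by (subst mult_diagonal_vec) (auto intro!: eq_vecI)
  moreover have "unit_vec n i \<noteq> (0\<^sub>v n :: 'a vec)"
    using i by simp
  ultimately show "e \<in> spectrum ?D"
    unfolding spectrum_def eigenvalue_def eigenvector_def
    by (auto intro!: exI[of _ "unit_vec n i"])
qed

lemma lambda_min_diagonal:
  "lambda_min (mat n n (\<lambda>(i, j). if i = j then d i else 0)) = Min (d ` {..<n})"
  by (simp add: lambda_min_def spectrum_diagonal)

section \<open>The propagator of the truncated wave equation\<close>

text \<open>For blocks of size 2, \<open>i div 2\<close> selects the block and
  \<open>i mod 2\<close> the position inside it. The induction peels off the first block, which
  shifts the remaining indices by 2.\<close>

lemma diag_block_mat_pairs:
  assumes "\<And>A. A \<in> set As \<Longrightarrow> A \<in> carrier_mat 2 2"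
  shows "diag_block_mat As \<in> carrier_mat (2 * length As) (2 * length As) \<and>
    (\<forall>i < 2 * length As. \<forall>j < 2 * length As. diag_block_mat As $$ (i, j) =
      (if i div 2 = j div 2 then (As ! (i div 2)) $$ (i mod 2, j mod 2) else 0))"
  using assms
proof (induction As)
  case (Cons A As)
  let ?n = "length As" and ?B = "diag_block_mat As"
  have A: "A \<in> carrier_mat 2 2" using Cons.prems by simp
  have IH: "?B \<in> carrier_mat (2 * ?n) (2 * ?n)"
    "\<And>i j. i < 2 * ?n \<Longrightarrow> j < 2 * ?n \<Longrightarrow> ?B $$ (i, j) =
      (if i div 2 = j div 2 then (As ! (i div 2)) $$ (i mod 2, j mod 2) else 0)"
    using Cons by auto
  have shift: "i div 2 = Suc ((i - 2) div 2)" "i mod 2 = (i - 2) mod 2" if "\<not> i < 2" for i :: nat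
    using that by (auto simp: div_if mod_if)
  have small: "i div 2 = 0" "i mod 2 = i" if "i < 2" for i :: nat
    using that by auto
  have "diag_block_mat (A # As) $$ (i, j) =
      (if i div 2 = j div 2 then ((A # As) ! (i div 2)) $$ (i mod 2, j mod 2) else 0)"
    if "i < 2 * Suc ?n" "j < 2 * Suc ?n" for i j
    using that A IH by (cases "i < 2"; cases "j < 2") (simp_all add: Let_def shift small)
  thus ?case using A IH(1) by (auto simp: Let_def)
qed auto

text \<open>Coordinates are indexed from 0, so \<open>2k\<close> and \<open>2k + 1\<close> belong to mode \<open>k + 1\<close>.\<close>
definition mode :: "nat \<Rightarrow> real" where
  "mode i = real (i div 2 + 1)"

text \<open>The block \<open>-jJ\<close> has rows \<open>(0, j)\<close> and \<open>(-j, 0)\<close>,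
  so even rows carry the positive sign and odd rows the negative one.\<close>

lemma wave_mat_eq:
  "wave_mat N = mat (2 * N) (2 * N) (\<lambda>(i, j).
     if i div 2 = j div 2 \<and> i \<noteq> j then (if even i then mode i else - mode i) else 0)"
proof -
  let ?As = "map (\<lambda>j. - (real j \<cdot>\<^sub>m J_mat)) [1..<N + 1]"
  have J: "J_mat \<in> carrier_mat 2 2" "J_mat $$ (0, 0) = 0" "J_mat $$ (0, Suc 0) = -1"
    "J_mat $$ (Suc 0, 0) = 1" "J_mat $$ (Suc 0, Suc 0) = 0"
    by (auto simp: J_mat_def mat_of_rows_list_def)
  have carr: "\<And>A. A \<in> set ?As \<Longrightarrow> A \<in> carrier_mat 2 2" using J by auto
  have len: "length ?As = N" by simp
  note P = diag_block_mat_pairs[of ?As, OF carr, unfolded len, folded wave_mat_def]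
  have "wave_mat N $$ (i, j) =
      (if i div 2 = j div 2 \<and> i \<noteq> j then (if even i then mode i else - mode i) else 0)"
    if ij: "i < 2 * N" "j < 2 * N" for i j
  proof (cases "i div 2 = j div 2")
    case True
    have lt: "i div 2 < N" using ij by auto
    have nth: "?As ! (i div 2) = - (real (i div 2 + 1) \<cdot>\<^sub>m J_mat)"
      using lt by (simp del: upt_Suc)
    have eq: "wave_mat N $$ (i, j) = (- (real (i div 2 + 1) \<cdot>\<^sub>m J_mat)) $$ (i mod 2, j mod 2)"
      using P ij True nth by (simp del: upt_Suc)
    have "i = j \<longleftrightarrow> i mod 2 = j mod 2" using True by (metis div_mult_mod_eq)
    thus ?thesis using True J unfolding eq
      by (cases "even i"; cases "even j")
         (auto simp: even_iff_mod_2_eq_zero odd_iff_mod_2_eq_one mode_def)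
  qed (use P ij in auto)
  thus ?thesis using P by (intro eq_matI) auto
qed

text \<open>Reduces products with a block-diagonal factor to the two indices of a single
  mode.\<close>

lemma sum_block:
  fixes f :: "nat \<Rightarrow> 'a :: comm_monoid_add"
  assumes "q < N" "\<And>l. l < 2 * N \<Longrightarrow> l div 2 \<noteq> q \<Longrightarrow> f l = 0"
  shows "(\<Sum>l = 0..<2 * N. f l) = f (2 * q) + f (2 * q + 1)"
proof -
  have "(\<Sum>l = 0..<2 * N. f l) = (\<Sum>l \<in> {2 * q, 2 * q + 1}. f l)"
  proof (intro sum.mono_neutral_right ballI)
    fix l assume l: "l \<in> {0..<2 * N} - {2 * q, 2 * q + 1}"
    hence "l \<noteq> 2 * q" "l \<noteq> 2 * q + 1" by auto
    hence "l div 2 \<noteq> q" by presburger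
    thus "f l = 0" using assms(2) l by simp
  qed (use assms(1) in auto)
  thus ?thesis by simp
qed

text \<open>Closed form of \<open>exp(tA)\<close>: in the plane of mode \<open>j\<close>, the
  clockwise rotation by the angle \<open>jt\<close>.\<close>

definition propagator :: "nat \<Rightarrow> real \<Rightarrow> real mat" where
  "propagator N t = mat (2 * N) (2 * N) (\<lambda>(i, j).
     if i div 2 = j div 2
     then (if i = j then cos (mode i * t)
           else if even i then sin (mode i * t) else - sin (mode i * t))
     else 0)"

lemma propagator_carrier: "propagator N t \<in> carrier_mat (2 * N) (2 * N)"
  by (simp add: propagator_def)

lemma double_index_cases:
  fixes i :: nat
  assumes "i < 2 * N"
  obtains p where "p < N" "i = 2 * p" | p where "p < N" "i = 2 * p + 1"
proof (cases "even i")
  case True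
  then obtain p where "i = 2 * p" by (elim evenE)
  thus ?thesis using that(1)[of p] assms by simp
next
  case False
  then obtain p where "i = 2 * p + 1" by (elim oddE)
  thus ?thesis using that(2)[of p] assms by simp
qed

text \<open>Since \<open>cos_coeff\<close> vanishes at odd and \<open>sin_coeff\<close> at even
  indices, one formula covers powers of both parities. The factor \<open>fact k\<close> cancels
  against the exponential series, leaving the Taylor terms of cosine and sine.\<close>

lemma wave_mat_power:
  assumes "i < 2 * N" "j < 2 * N"
  shows "((t \<cdot>\<^sub>m wave_mat N) ^\<^sub>m k) $$ (i, j) = fact k *
     (if i div 2 = j div 2
      then (if i = j then cos_coeff k * (mode i * t) ^ k
            else if even i then sin_coeff k * (mode i * t) ^ k
            else - (sin_coeff k * (mode i * t) ^ k))
      else 0)"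
  using assms
proof (induction k arbitrary: i j)
  case 0
  thus ?case by (simp add: wave_mat_eq)
next
  case (Suc k)
  let ?A = "t \<cdot>\<^sub>m wave_mat N"
  have A: "?A \<in> carrier_mat (2 * N) (2 * N)" by (simp add: wave_mat_eq)
  have Ak: "?A ^\<^sub>m k \<in> carrier_mat (2 * N) (2 * N)" using A by simp
  define q where "q = j div 2"
  have q: "q < N" using Suc.prems q_def by auto
  have "(?A ^\<^sub>m Suc k) $$ (i, j) = (\<Sum>l = 0..<2 * N. (?A ^\<^sub>m k) $$ (i, l) * ?A $$ (l, j))"
    using carrier_matD[OF A] carrier_matD[OF Ak] Suc.prems by (simp add: scalar_prod_def)
  also have "\<dots> = (?A ^\<^sub>m k) $$ (i, 2 * q) * ?A $$ (2 * q, j)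
      + (?A ^\<^sub>m k) $$ (i, 2 * q + 1) * ?A $$ (2 * q + 1, j)"
    using q Suc.prems by (intro sum_block) (auto simp: wave_mat_eq q_def)
  finally have step: "(?A ^\<^sub>m Suc k) $$ (i, j) = \<dots>" .
  \<comment> \<open>Multiplication by one more factor of the matrix turns cosine coefficients into
    sine coefficients and conversely; these recurrences express this with denominators
    cleared.\<close>
  have coeffs: "fact (Suc k) * cos_coeff (Suc k) = - (fact k * sin_coeff k)"
    "fact (Suc k) * sin_coeff (Suc k) = fact k * cos_coeff k"
    by (simp_all add: cos_coeff_Suc sin_coeff_Suc del: of_nat_Suc)
  have coeffs': "fact (Suc k) * (cos_coeff (Suc k) * x) = - (fact k * sin_coeff k * x)"
    "fact (Suc k) * (sin_coeff (Suc k) * x) = fact k * cos_coeff k * x"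
    "fact (Suc k) * (- (sin_coeff (Suc k) * x)) = - (fact k * cos_coeff k * x)" for x :: real
    using coeffs by (simp_all add: mult.assoc[symmetric] del: fact_Suc)
  have IH: "(?A ^\<^sub>m k) $$ (i, 2 * q) = fact k * (if i div 2 = q then (if i = 2 * q
      then cos_coeff k * (mode i * t) ^ k else if even i then sin_coeff k * (mode i * t) ^ k
      else - (sin_coeff k * (mode i * t) ^ k)) else 0)"
    "(?A ^\<^sub>m k) $$ (i, 2 * q + 1) = fact k * (if i div 2 = q then (if i = 2 * q + 1
      then cos_coeff k * (mode i * t) ^ k else if even i then sin_coeff k * (mode i * t) ^ k
      else - (sin_coeff k * (mode i * t) ^ k)) else 0)"
    using Suc.IH[of i "2 * q"] Suc.IH[of i "2 * q + 1"] Suc.prems q by simp_all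
  obtain p where p: "p < N" "i = 2 * p \<or> i = 2 * p + 1"
    using Suc.prems(1) by (elim double_index_cases) auto
  have j: "j = 2 * q \<or> j = 2 * q + 1" unfolding q_def by presburger
  show ?case
    unfolding step IH using p j q
    by (elim disjE) (auto simp: wave_mat_eq coeffs' mode_def algebra_simps simp del: fact_Suc)
qed

lemma mat_exp_wave_mat: "mat_exp (t \<cdot>\<^sub>m wave_mat N) = propagator N t"
proof (intro eq_matI)
  have dims: "dim_row (wave_mat N) = 2 * N" by (simp add: wave_mat_eq)
  show "dim_row (mat_exp (t \<cdot>\<^sub>m wave_mat N)) = dim_row (propagator N t)"
    "dim_col (mat_exp (t \<cdot>\<^sub>m wave_mat N)) = dim_col (propagator N t)"
    by (simp_all add: mat_exp_def wave_mat_eq propagator_def)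
  fix i j assume "i < dim_row (propagator N t)" "j < dim_col (propagator N t)"
  hence ij: "i < 2 * N" "j < 2 * N" by (auto simp: propagator_def)
  have C: "(\<Sum>k. cos_coeff k * x ^ k) = cos x" and S: "(\<Sum>k. sin_coeff k * x ^ k) = sin x"
    and S': "(\<Sum>k. - (sin_coeff k * x ^ k)) = - sin x" for x :: real
    using cos_converges[of x] sin_converges[of x] sums_minus[OF sin_converges[of x]]
    by (simp_all add: sums_iff)
  show "mat_exp (t \<cdot>\<^sub>m wave_mat N) $$ (i, j) = propagator N t $$ (i, j)"
    using ij by (auto simp: mat_exp_def propagator_def dims wave_mat_power C S S')
qed

text \<open>The matrix is skew-symmetric, so transposing it reverses time; since cosine is even and
  sine is odd, reversing time transposes the rotation blocks.\<close>

lemma mat_exp_wave_mat_transpose: "mat_exp (t \<cdot>\<^sub>m (wave_mat N)\<^sup>T) = (propagator N t)\<^sup>T"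
proof -
  have "t \<cdot>\<^sub>m (wave_mat N)\<^sup>T = (- t) \<cdot>\<^sub>m wave_mat N"
  proof (intro eq_matI)
    fix i j assume "i < dim_row ((- t) \<cdot>\<^sub>m wave_mat N)" "j < dim_col ((- t) \<cdot>\<^sub>m wave_mat N)"
    hence ij: "i < 2 * N" "j < 2 * N" by (auto simp: wave_mat_eq)
    show "(t \<cdot>\<^sub>m (wave_mat N)\<^sup>T) $$ (i, j) = ((- t) \<cdot>\<^sub>m wave_mat N) $$ (i, j)"
    proof (cases "i div 2 = j div 2 \<and> i \<noteq> j")
      case True
      hence "even i \<noteq> even j" by presburger
      moreover have "mode i = mode j" using True by (simp add: mode_def)
      ultimately show ?thesis using ij True by (cases "even i") (simp_all add: wave_mat_eq)
    qed (use ij in \<open>auto simp: wave_mat_eq\<close>)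
  qed (simp_all add: wave_mat_eq)
  hence "mat_exp (t \<cdot>\<^sub>m (wave_mat N)\<^sup>T) = propagator N (- t)"
    by (simp add: mat_exp_wave_mat)
  also have "\<dots> = (propagator N t)\<^sup>T"
  proof (intro eq_matI)
    fix i j assume "i < dim_row ((propagator N t)\<^sup>T)" "j < dim_col ((propagator N t)\<^sup>T)"
    hence ij: "i < 2 * N" "j < 2 * N" by (auto simp: propagator_def)
    show "propagator N (- t) $$ (i, j) = (propagator N t)\<^sup>T $$ (i, j)"
    proof (cases "i div 2 = j div 2 \<and> i \<noteq> j")
      case True
      hence "even i \<noteq> even j" by presburger
      moreover have "mode i = mode j" using True by (simp add: mode_def)
      ultimately show ?thesis using ij True by (cases "even i") (simp_all add: propagator_def)
    qed (use ij in \<open>auto simp: propagator_def\<close>)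
  qed (simp_all add: propagator_def)
  finally show ?thesis .
qed

text \<open>Within a mode the two remaining terms add up to \<open>cos^2 + sin^2\<close> on the
  diagonal and cancel off it.\<close>

lemma propagator_orthogonal: "propagator N t * (propagator N t)\<^sup>T = 1\<^sub>m (2 * N)"
proof (intro eq_matI)
  fix i j assume "i < dim_row (1\<^sub>m (2 * N) :: real mat)" "j < dim_col (1\<^sub>m (2 * N) :: real mat)"
  hence ij: "i < 2 * N" "j < 2 * N" by auto
  define q where "q = j div 2"
  have q: "q < N" using ij q_def by auto
  let ?E = "propagator N t"
  have "(?E * ?E\<^sup>T) $$ (i, j) = (\<Sum>l = 0..<2 * N. ?E $$ (i, l) * ?E $$ (j, l))"
    using ij propagator_carrier[of N t] by (simp add: scalar_prod_def)
  also have "\<dots> = ?E $$ (i, 2 * q) * ?E $$ (j, 2 * q)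
      + ?E $$ (i, 2 * q + 1) * ?E $$ (j, 2 * q + 1)"
    using q ij by (intro sum_block) (auto simp: propagator_def q_def)
  finally have step: "(?E * ?E\<^sup>T) $$ (i, j) = \<dots>" .
  obtain p where p: "p < N" "i = 2 * p \<or> i = 2 * p + 1"
    using ij(1) by (elim double_index_cases) auto
  have j: "j = 2 * q \<or> j = 2 * q + 1" unfolding q_def by presburger
  show "(?E * ?E\<^sup>T) $$ (i, j) = 1\<^sub>m (2 * N) $$ (i, j)"
    unfolding step using p j q
    by (elim disjE) (auto simp: propagator_def mode_def simp flip: power2_eq_square)
qed (simp_all add: propagator_def)

lemma propagator_orthogonal': "(propagator N t)\<^sup>T * propagator N t = 1\<^sub>m (2 * N)"
  using mat_mult_left_right_inverse[OF propagator_carrier _ propagator_orthogonal]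
    propagator_carrier by simp

lemma cov_integral_wave:
  "cov_integral (wave_mat N) T X = mat (2 * N) (2 * N) (\<lambda>ij.
     integral {0..T} (\<lambda>t. (propagator N t * X * (propagator N t)\<^sup>T) $$ ij))"
  unfolding cov_integral_def mat_exp_wave_mat mat_exp_wave_mat_transpose
  by (simp add: wave_mat_eq)

section \<open>The covariance relaxation\<close>

lemma conjugated_entry:
  assumes "X \<in> carrier_mat (2 * N) (2 * N)" "i < 2 * N" "j < 2 * N"
  shows "(propagator N t * X * (propagator N t)\<^sup>T) $$ (i, j) =
    (\<Sum>k = 0..<2 * N. \<Sum>l = 0..<2 * N.
       propagator N t $$ (i, k) * X $$ (k, l) * propagator N t $$ (j, l))"
  using assms propagator_carrier[of N t] by (simp add: scalar_prod_def sum_distrib_left mult.assoc)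

lemma propagator_continuous:
  assumes "i < 2 * N" "j < 2 * N"
  shows "continuous_on S (\<lambda>t. propagator N t $$ (i, j))"
  using assms by (cases "i div 2 = j div 2"; cases "i = j"; cases "even i")
    (auto simp: propagator_def intro!: continuous_intros)

lemma cov_integral_symmetric:
  assumes X: "X \<in> carrier_mat (2 * N) (2 * N)" and sym: "X\<^sup>T = X"
  shows "(cov_integral (wave_mat N) T X)\<^sup>T = cov_integral (wave_mat N) T X"
proof (intro eq_matI)
  fix i j assume "i < dim_row (cov_integral (wave_mat N) T X)"
    "j < dim_col (cov_integral (wave_mat N) T X)"
  hence ij: "i < 2 * N" "j < 2 * N" by (simp_all add: cov_integral_wave)
  have X_sym: "X $$ (k, l) = X $$ (l, k)" if "k < 2 * N" "l < 2 * N" for k l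
    using arg_cong[OF sym, of "\<lambda>A. A $$ (k, l)"] that X by simp
  have "(propagator N t * X * (propagator N t)\<^sup>T) $$ (j, i) =
      (propagator N t * X * (propagator N t)\<^sup>T) $$ (i, j)" for t
    unfolding conjugated_entry[OF X ij] conjugated_entry[OF X ij(2,1)]
    by (subst sum.swap, intro sum.cong refl) (simp add: X_sym mult_ac)
  thus "(cov_integral (wave_mat N) T X)\<^sup>T $$ (i, j) = cov_integral (wave_mat N) T X $$ (i, j)"
    using ij by (simp add: cov_integral_wave)
qed (simp_all add: cov_integral_wave)

text \<open>By cyclicity of the trace and orthogonality of the propagator, the integrand has trace
  \<open>mat_trace X\<close> at every time.\<close>

lemma cov_integral_trace:
  assumes X: "X \<in> carrier_mat (2 * N) (2 * N)" and "T \<ge> 0"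
  shows "mat_trace (cov_integral (wave_mat N) T X) = T * mat_trace X"
proof -
  let ?F = "\<lambda>t. propagator N t * X * (propagator N t)\<^sup>T"
  \<comment> \<open>Integrability of the diagonal entries justifies exchanging the trace with the
    integral.\<close>
  have int: "(\<lambda>t. ?F t $$ (i, i)) integrable_on {0..T}" if "i < 2 * N" for i
    unfolding conjugated_entry[OF X that that]
    by (intro integrable_continuous_real continuous_on_sum continuous_on_mult
        continuous_on_const propagator_continuous) (use that in auto)
  have tr: "(\<Sum>i<2 * N. ?F t $$ (i, i)) = mat_trace X" for t
  proof -
    have E: "propagator N t \<in> carrier_mat (2 * N) (2 * N)" by (rule propagator_carrier)
    have "(\<Sum>i<2 * N. ?F t $$ (i, i)) =
        (\<Sum>i<2 * N. ((propagator N t)\<^sup>T * (propagator N t * X)) $$ (i, i))"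
      using E X by (intro trace_mult_commute) auto
    also have "(propagator N t)\<^sup>T * (propagator N t * X) = X"
      using E X assoc_mult_mat[of "(propagator N t)\<^sup>T" "2 * N" "2 * N" "propagator N t" "2 * N" X "2 * N"]
      by (simp add: propagator_orthogonal')
    finally show ?thesis using X by (simp add: mat_trace_def)
  qed
  have "mat_trace (cov_integral (wave_mat N) T X) = (\<Sum>i<2 * N. integral {0..T} (\<lambda>t. ?F t $$ (i, i)))"
    by (simp add: mat_trace_def cov_integral_wave)
  also have "\<dots> = integral {0..T} (\<lambda>t. \<Sum>i<2 * N. ?F t $$ (i, i))"
    using int by (intro integral_sum[symmetric]) auto
  also have "\<dots> = T * mat_trace X" unfolding tr using \<open>T \<ge> 0\<close> by simp
  finally show ?thesis .
qed

lemma relaxed_value_le: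
  assumes "N \<ge> 1" "T \<ge> 0" "X \<in> carrier_mat (2 * N) (2 * N)" "X\<^sup>T = X" "mat_trace X = 1"
  shows "lambda_min (cov_integral (wave_mat N) T X) \<le> T / (2 * real N)"
proof -
  have "cov_integral (wave_mat N) T X \<in> carrier_mat (2 * N) (2 * N)"
    by (simp add: cov_integral_wave)
  from lambda_min_le_trace[OF this cov_integral_symmetric[OF assms(3,4)]]
  have "real (2 * N) * lambda_min (cov_integral (wave_mat N) T X) \<le> T"
    using cov_integral_trace[OF assms(3,2)] assms(5) by simp
  thus ?thesis using assms(1) by (simp add: field_simps)
qed

text \<open>Multiples of the identity are unchanged under conjugation by an orthogonal matrix, so
  the integrand is constant.\<close>

lemma cov_integral_scalar:
  assumes "T \<ge> 0"
  shows "cov_integral (wave_mat N) T (c \<cdot>\<^sub>m 1\<^sub>m (2 * N)) =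
    mat (2 * N) (2 * N) (\<lambda>(i, j). if i = j then T * c else 0)"
proof -
  have E: "propagator N t \<in> carrier_mat (2 * N) (2 * N)" for t by (rule propagator_carrier)
  have "propagator N t * (c \<cdot>\<^sub>m 1\<^sub>m (2 * N)) * (propagator N t)\<^sup>T = c \<cdot>\<^sub>m 1\<^sub>m (2 * N)" for t
    using E[of t] by (simp add: propagator_orthogonal mult_smult_distrib[of _ "2 * N" "2 * N" _ "2 * N"]
        mult_smult_assoc_mat[of _ "2 * N" "2 * N" _ "2 * N"])
  thus ?thesis unfolding cov_integral_wave using assms by (intro eq_matI) auto
qed

lemma relaxed_values_maximum:
  assumes "N \<ge> 1" "T \<ge> 0"
  shows "is_maximum (relaxed_values (wave_mat N) T) (T / (2 * real N))"
  unfolding is_maximum_def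
proof (intro conjI ballI)
  have dim: "dim_row (wave_mat N) = 2 * N" by (simp add: wave_mat_eq)
  \<comment> \<open>The isotropic covariance, normalised to trace 1. Its integral is again a
    multiple of the identity, so all eigenvalues equal their mean and the trace bound is
    attained.\<close>
  define X :: "real mat" where "X = (1 / (2 * real N)) \<cdot>\<^sub>m 1\<^sub>m (2 * N)"
  have "pos_semidef X"
    unfolding pos_semidef_def
  proof (intro conjI ballI)
    fix v :: "real vec" assume "v \<in> carrier_vec (dim_row X)"
    hence v: "v \<in> carrier_vec (2 * N)" by (simp add: X_def)
    have "X = mat (2 * N) (2 * N) (\<lambda>(i, j). if i = j then 1 / (2 * real N) else 0)"
      unfolding X_def by (intro eq_matI) auto
    hence "v \<bullet> (X *\<^sub>v v) = 1 / (2 * real N) * (v \<bullet> v)"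
      using v by (simp add: mult_diagonal_vec scalar_prod_def sum_divide_distrib)
    moreover have "v \<bullet> v \<ge> 0" by (simp add: scalar_prod_def sum_nonneg)
    ultimately show "0 \<le> v \<bullet> (X *\<^sub>v v)" by simp
  qed (auto simp: X_def)
  moreover have "mat_trace X = 1" using assms by (simp add: mat_trace_def X_def)
  moreover have "lambda_min (cov_integral (wave_mat N) T X) = T / (2 * real N)"
  proof -
    have "(\<lambda>i. T * (1 / (2 * real N))) ` {..<2 * N} = {T / (2 * real N)}"
      using assms by (subst image_constant[of 0]) auto
    thus ?thesis
      unfolding X_def cov_integral_scalar[OF assms(2)] lambda_min_diagonal by simp
  qed
  ultimately show "T / (2 * real N) \<in> relaxed_values (wave_mat N) T"
    unfolding relaxed_values_def dim by (auto intro!: exI[of _ X] simp: X_def)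
  fix x assume "x \<in> relaxed_values (wave_mat N) T"
  thus "x \<le> T / (2 * real N)"
    unfolding relaxed_values_def dim pos_semidef_def
    using relaxed_value_le[OF assms] by auto
qed

section \<open>The Gramian of the truncated wave equation\<close>

text \<open>A nonzero integer frequency completes whole periods on an interval whose length is a
  multiple of \<open>2 * pi\<close>. The shift \<open>c\<close> lets the same statement serve
  cosines and sines.\<close>

lemma integral_cos_full_periods:
  fixes p :: int and c :: real
  assumes "T = 2 * pi * real M"
  shows "((\<lambda>t. cos (of_int p * t + c)) has_integral (if p = 0 then T * cos c else 0)) {0..T}"
proof (cases "p = 0")
  case True
  have "0 \<le> T" using assms by simp
  thus ?thesis using True has_integral_const_real[of "cos c" 0 T] by simp
next
  case False
  have "0 \<le> T" using assms by simp
  moreover have "((\<lambda>t. sin (of_int p * t + c) / of_int p) has_vector_derivative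
      cos (of_int p * t + c)) (at t within {0..T})" for t
    using False unfolding has_real_derivative_iff_has_vector_derivative[symmetric]
    by (auto intro!: derivative_eq_intros)
  ultimately have "((\<lambda>t. cos (of_int p * t + c)) has_integral
      (sin (of_int p * T + c) / of_int p - sin (of_int p * 0 + c) / of_int p)) {0..T}"
    by (intro fundamental_theorem_of_calculus) auto
  moreover have "sin (of_int p * T + c) = sin c"
  proof -
    have "of_int p * T + c = c + 2 * pi * of_int (p * int M)"
      using assms by (simp add: algebra_simps)
    thus ?thesis
      by (metis (no_types) sin_add sin_int_2pin cos_int_2pin add.right_neutral mult.right_neutral mult_zero_right)
  qed
  ultimately show ?thesis using False by simp
qed

text \<open>Writing \<open>sin x = cos (x - pi / 2)\<close> treats position and velocity coordinates uniformly.\<close>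
definition phase :: "nat \<Rightarrow> real" where
  "phase i = (if even i then pi / 2 else 0)"

text \<open>The product-to-sum formula leaves a difference frequency \<open>?d\<close> and a sum
  frequency \<open>?s\<close>. The latter is at least 2 and integrates to 0; the former survives
  only within one mode.\<close>

lemma integral_mode_product:
  assumes "T = 2 * pi * real M"
  shows "((\<lambda>t. cos (mode i * t - phase i) * cos (mode j * t - phase j))
    has_integral (if i = j then T / 2 else 0)) {0..T}"
proof -
  let ?d = "int (i div 2) - int (j div 2)" and ?s = "int (i div 2) + int (j div 2) + 2"
  let ?m = "phase j - phase i" and ?p = "- (phase i + phase j)"
  have prod: "cos (mode i * t - phase i) * cos (mode j * t - phase j) =
      (cos (of_int ?d * t + ?m) + cos (of_int ?s * t + ?p)) / 2" for t
    by (simp add: cos_times_cos mode_def algebra_simps)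
  have "((\<lambda>t. (cos (of_int ?d * t + ?m) + cos (of_int ?s * t + ?p)) / 2) has_integral
      ((if ?d = 0 then T * cos ?m else 0) + (if ?s = 0 then T * cos ?p else 0)) / 2) {0..T}"
    by (intro has_integral_divide has_integral_add integral_cos_full_periods[OF assms])
  moreover have "((if ?d = 0 then T * cos ?m else 0) + (if ?s = 0 then T * cos ?p else 0)) / 2 =
      (if i = j then T / 2 else 0)"
  \<comment> \<open>The two coordinates of one mode have phases differing by \<open>pi / 2\<close>,
    so the constant term \<open>cos ?m\<close> vanishes.\<close>
  proof (cases "i div 2 = j div 2 \<and> i \<noteq> j")
    case True
    hence "even i \<noteq> even j" by presburger
    thus ?thesis using True by (auto simp: phase_def)
  qed auto
  ultimately show ?thesis unfolding prod by simp
qed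

lemma wave_input_eq: "wave_input N b = vec (2 * N) (\<lambda>i. if even i then 0 else b $ (i div 2))"
proof -
  \<comment> \<open>The prefix length varies while \<open>b\<close> stays fixed, so that the
    induction appends one pair at the end and leaves earlier indices in place.\<close>
  define L where "L n = concat (map (\<lambda>j. [0, b $ (j - 1)]) [1..<n + 1])" for n
  have L_Suc: "L (Suc n) = L n @ [0, b $ n]" for n
    by (simp add: L_def)
  have len: "length (L n) = 2 * n" for n
    by (induction n) (auto simp: L_Suc, simp add: L_def)
  have "L n ! i = (if even i then 0 else b $ (i div 2))" if "i < 2 * n" for n i
    using that
  proof (induction n)
    case (Suc n)
    have "i < 2 * n \<or> i = 2 * n \<or> i = 2 * n + 1" using Suc.prems by auto
    thus ?case
      using Suc.IH by (elim disjE) (auto simp: L_Suc nth_append len)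
  qed simp
  thus ?thesis unfolding wave_input_def L_def[symmetric]
    using len[of N] by (intro eq_vecI) (auto simp: vec_of_list_index)
qed

text \<open>Only the velocity entry of a mode is forced. Its column in the rotation block is
  \<open>(sin jt, cos jt)\<close>, and \<open>phase\<close> writes both entries as shifted
  cosines.\<close>

lemma propagator_wave_input:
  assumes "i < 2 * N"
  shows "(\<Sum>k = 0..<2 * N. propagator N t $$ (i, k) * wave_input N b $ k) =
    b $ (i div 2) * cos (mode i * t - phase i)"
proof -
  define q where "q = i div 2"
  have q: "q < N" using assms q_def by auto
  have "(\<Sum>k = 0..<2 * N. propagator N t $$ (i, k) * wave_input N b $ k) =
      propagator N t $$ (i, 2 * q) * wave_input N b $ (2 * q)
      + propagator N t $$ (i, 2 * q + 1) * wave_input N b $ (2 * q + 1)"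
    using q assms by (intro sum_block) (auto simp: propagator_def q_def)
  moreover have "i = 2 * q \<or> i = 2 * q + 1" unfolding q_def by presburger
  ultimately show ?thesis
    using q by (elim disjE) (auto simp: propagator_def wave_input_eq phase_def cos_diff)
qed

text \<open>The integrand is the outer square of the vector \<open>exp(tA)\<close> applied to the
  input, so each entry is a product of two shifted cosines, and distinct coordinates are orthogonal
  over full periods.\<close>

lemma gramian_wave:
  assumes "T = 2 * pi * real M"
  shows "gramian T (wave_mat N) (wave_input N b) =
    mat (2 * N) (2 * N) (\<lambda>(i, j). if i = j then T / 2 * (b $ (i div 2))\<^sup>2 else 0)"
proof -
  let ?w = "wave_input N b"
  have X: "outer_square ?w \<in> carrier_mat (2 * N) (2 * N)"
    by (simp add: outer_square_def wave_input_eq)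
  have entry: "(propagator N t * outer_square ?w * (propagator N t)\<^sup>T) $$ (i, j) =
      b $ (i div 2) * b $ (j div 2) * (cos (mode i * t - phase i) * cos (mode j * t - phase j))"
    if ij: "i < 2 * N" "j < 2 * N" for i j t
  proof -
    \<comment> \<open>The outer square has rank at most one, which makes the double sum
      factor.\<close>
    have "(propagator N t * outer_square ?w * (propagator N t)\<^sup>T) $$ (i, j) =
        (\<Sum>k = 0..<2 * N. propagator N t $$ (i, k) * ?w $ k)
        * (\<Sum>l = 0..<2 * N. propagator N t $$ (j, l) * ?w $ l)"
      unfolding conjugated_entry[OF X ij] sum_product
      by (intro sum.cong refl) (simp add: outer_square_def wave_input_eq mult_ac)
    thus ?thesis
      unfolding propagator_wave_input[OF ij(1)] propagator_wave_input[OF ij(2)]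
      by (simp add: mult_ac)
  qed
  have "integral {0..T} (\<lambda>t. (propagator N t * outer_square ?w * (propagator N t)\<^sup>T) $$ (i, j)) =
      (if i = j then T / 2 * (b $ (i div 2))\<^sup>2 else 0)" if ij: "i < 2 * N" "j < 2 * N" for i j
    unfolding entry[OF ij]
    by (subst integral_unique[OF has_integral_mult_right[OF integral_mode_product[OF assms]]])
       (simp add: power2_eq_square)
  thus ?thesis unfolding gramian_def cov_integral_wave by (intro eq_matI) auto
qed

section \<open>Optimal profiles\<close>

text \<open>Both coordinates of a mode carry the same diagonal entry, so the minimum over
  coordinates is a minimum over modes.\<close>

lemma wave_lambda_eq:
  assumes "T = 2 * pi * real M"
  shows "wave_lambda N T b = Min ((\<lambda>j. T / 2 * (b $ (j - 1))\<^sup>2) ` {1..N})"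
proof -
  have "(\<lambda>i. T / 2 * (b $ (i div 2))\<^sup>2) ` {..<2 * N} = (\<lambda>j. T / 2 * (b $ (j - 1))\<^sup>2) ` {1..N}"
  proof (intro equalityI subsetI; elim imageE)
    fix x i assume "x = T / 2 * (b $ (i div 2))\<^sup>2" "i \<in> {..<2 * N}"
    thus "x \<in> (\<lambda>j. T / 2 * (b $ (j - 1))\<^sup>2) ` {1..N}"
      by (intro image_eqI[of _ _ "i div 2 + 1"]) auto
  next
    fix x j assume "x = T / 2 * (b $ (j - 1))\<^sup>2" "j \<in> {1..N}"
    thus "x \<in> (\<lambda>i. T / 2 * (b $ (i div 2))\<^sup>2) ` {..<2 * N}"
      by (intro image_eqI[of _ _ "2 * (j - 1)"]) auto
  qed
  thus ?thesis unfolding wave_lambda_def gramian_wave[OF assms] lambda_min_diagonal by simp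
qed

lemma all_eq_mean_if_ge_mean:
  fixes f :: "'a \<Rightarrow> real"
  assumes "finite A" "\<And>x. x \<in> A \<Longrightarrow> c \<le> f x" "sum f A = real (card A) * c" "x \<in> A"
  shows "f x = c"
proof -
  have "(\<Sum>x\<in>A. f x - c) = 0" using assms(3) by (simp add: sum_subtractf)
  thus ?thesis using assms(1,2,4) by (subst (asm) sum_nonneg_eq_0_iff) auto
qed

text \<open>The bound says that every squared coefficient is at least \<open>1 / real N\<close>.
  These squares sum to 1, so none of them can exceed this mean.\<close>

lemma wave_lambda_ge_iff:
  assumes "N \<ge> 1" "M \<ge> 1" "T = 2 * pi * real M" and b: "b \<in> unit_profiles N"
  shows "wave_lambda N T b \<ge> T / (2 * real N) \<longleftrightarrow> (\<forall>j\<in>{1..N}. (b $ (j - 1))\<^sup>2 = 1 / real N)"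
proof -
  have T: "T > 0" using assms by simp
  have "wave_lambda N T b \<ge> T / (2 * real N) \<longleftrightarrow> (\<forall>j\<in>{1..N}. T / (2 * real N) \<le> T / 2 * (b $ (j - 1))\<^sup>2)"
    unfolding wave_lambda_eq[OF assms(3)] using assms(1) by (subst Min_ge_iff) auto
  also have "\<dots> \<longleftrightarrow> (\<forall>j\<in>{1..N}. 1 / real N \<le> (b $ (j - 1))\<^sup>2)"
    using T assms(1) by (intro ball_cong refl) (simp add: field_simps)
  also have "\<dots> \<longleftrightarrow> (\<forall>j\<in>{1..N}. (b $ (j - 1))\<^sup>2 = 1 / real N)"
  proof
    assume *: "\<forall>j\<in>{1..N}. 1 / real N \<le> (b $ (j - 1))\<^sup>2"
    show "\<forall>j\<in>{1..N}. (b $ (j - 1))\<^sup>2 = 1 / real N"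
    proof
      fix j assume "j \<in> {1..N}"
      thus "(b $ (j - 1))\<^sup>2 = 1 / real N"
        using * b assms(1) unfolding unit_profiles_def
        by (intro all_eq_mean_if_ge_mean[of "{1..N}" _ "\<lambda>j. (b $ (j - 1))\<^sup>2"]) auto
    qed
  qed auto
  finally show ?thesis .
qed

lemma wave_lambda_le:
  assumes "N \<ge> 1" "M \<ge> 1" "T = 2 * pi * real M" and b: "b \<in> unit_profiles N"
  shows "wave_lambda N T b \<le> T / (2 * real N)"
proof (rule ccontr)
  assume *: "\<not> ?thesis"
  hence "\<forall>j\<in>{1..N}. (b $ (j - 1))\<^sup>2 = 1 / real N"
    using wave_lambda_ge_iff[OF assms] by simp
  \<comment> \<open>The entry of mode 1 alone already bounds the minimum by
    \<open>T / (2 * real N)\<close>, contradicting the assumed strict excess.\<close>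
  hence "(b $ (1 - 1))\<^sup>2 = 1 / real N" using assms(1) by (elim ballE[of _ _ 1]) auto
  moreover have "wave_lambda N T b \<le> T / 2 * (b $ (1 - 1))\<^sup>2"
    unfolding wave_lambda_eq[OF assms(3)] using assms(1) by (intro Min_le image_eqI[of _ _ 1]) auto
  ultimately show False using * by simp
qed

lemma equal_moduli_unit_profile:
  assumes "N \<ge> 1" "b \<in> carrier_vec N" "\<forall>j\<in>{1..N}. (b $ (j - 1))\<^sup>2 = 1 / real N"
  shows "b \<in> unit_profiles N"
  using assms by (simp add: unit_profiles_def)

lemma wave_lambda_equal_moduli:
  assumes "N \<ge> 1" "M \<ge> 1" "T = 2 * pi * real M"
    "b \<in> carrier_vec N" "\<forall>j\<in>{1..N}. (b $ (j - 1))\<^sup>2 = 1 / real N"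
  shows "wave_lambda N T b = T / (2 * real N)"
  using wave_lambda_le[OF assms(1-3)] wave_lambda_ge_iff[OF assms(1-3)]
    equal_moduli_unit_profile[OF assms(1,4,5)] assms(5) by (intro antisym) auto

lemma vec_signs_square:
  assumes "\<forall>j\<in>{1..N}. \<epsilon> j \<in> {-1, 1 :: real}"
  shows "\<forall>j\<in>{1..N}. (vec N (\<lambda>i. \<epsilon> (i + 1) / sqrt (real N)) $ (j - 1))\<^sup>2 = 1 / real N"
  using assms by (force simp: power_divide)

lemma maximizing_profiles_eq:
  assumes "N \<ge> 1" "M \<ge> 1" "T = 2 * pi * real M"
  shows "maximizing_profiles N T = {b \<in> carrier_vec N. \<forall>j\<in>{1..N}. (b $ (j - 1))\<^sup>2 = 1 / real N}"
proof (intro equalityI subsetI)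
  fix b assume b: "b \<in> maximizing_profiles N T"
  \<comment> \<open>The flat profile with positive signs serves as competitor: a maximizer must do
    at least as well.\<close>
  let ?u = "vec N (\<lambda>i. 1 / sqrt (real N))"
  have u: "?u \<in> carrier_vec N" "\<forall>j\<in>{1..N}. (?u $ (j - 1))\<^sup>2 = 1 / real N"
    using vec_signs_square[of N "\<lambda>_. 1"] by auto
  have bu: "b \<in> unit_profiles N" and "\<not> wave_lambda N T b < wave_lambda N T ?u"
    using b equal_moduli_unit_profile[OF assms(1) u]
    unfolding maximizing_profiles_def is_arg_max_def by auto
  hence "wave_lambda N T b \<ge> T / (2 * real N)"
    using wave_lambda_equal_moduli[OF assms u] by simp
  thus "b \<in> {b \<in> carrier_vec N. \<forall>j\<in>{1..N}. (b $ (j - 1))\<^sup>2 = 1 / real N}"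
    using wave_lambda_ge_iff[OF assms bu] bu by (simp add: unit_profiles_def)
next
  fix b assume "b \<in> {b \<in> carrier_vec N. \<forall>j\<in>{1..N}. (b $ (j - 1))\<^sup>2 = 1 / real N}"
  hence b: "b \<in> carrier_vec N" "\<forall>j\<in>{1..N}. (b $ (j - 1))\<^sup>2 = 1 / real N" by auto
  show "b \<in> maximizing_profiles N T"
    unfolding maximizing_profiles_def is_arg_max_def
    using equal_moduli_unit_profile[OF assms(1) b] wave_lambda_le[OF assms]
      wave_lambda_equal_moduli[OF assms b] by (auto simp: not_less)
qed

section \<open>Sobolev regularity of unimodular profiles\<close>

text \<open>With unit moduli the weighted series becomes the series of
  \<open>j powr (-2 * s)\<close>, which converges exactly when \<open>-2 * s < -1\<close>.\<close>

lemma unimodular_in_H_D_neg_iff: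
  assumes "\<forall>j\<ge>1. \<bar>b j\<bar> = 1"
  shows "b \<in> H_D_neg s \<longleftrightarrow> s > 1 / 2"
proof -
  have "b \<in> H_D_neg s \<longleftrightarrow> (\<lambda>j. real j powr (- 2 * s)) summable_on {1..}"
    unfolding H_D_neg_def mem_Collect_eq using assms by (intro summable_on_cong) simp
  \<comment> \<open>The index 0 can be added because \<open>0 powr x\<close> is 0 for every
    exponent.\<close>
  also have "\<dots> \<longleftrightarrow> (\<lambda>j. real j powr (- 2 * s)) summable_on (UNIV :: nat set)"
    by (intro summable_on_cong_neutral) (auto simp: not_le)
  also have "\<dots> \<longleftrightarrow> summable (\<lambda>j. real j powr (- 2 * s))"
    by (intro summable_on_UNIV_nonneg_real_iff) auto
  also have "\<dots> \<longleftrightarrow> s > 1 / 2"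
    by (subst summable_real_powr_iff) auto
  finally show ?thesis .
qed

theorem proposition5p3:
  fixes N M :: nat and T :: real
  assumes "N \<ge> 1" and "M \<ge> 1" and "T = 2 * pi * real M"
  shows "is_maximum (wave_lambda N T ` unit_profiles N) (T / (2 * real N))
    \<and> maximizing_profiles N T
        = {b \<in> carrier_vec N. \<forall>j\<in>{1..N}. (b $ (j - 1))\<^sup>2 = 1 / real N}
    \<and> (\<forall>\<epsilon> :: nat \<Rightarrow> real. (\<forall>j\<in>{1..N}. \<epsilon> j \<in> {-1, 1}) \<longrightarrow>
        vec N (\<lambda>i. \<epsilon> (i + 1) / sqrt (real N)) \<in> maximizing_profiles N T)
    \<and> is_maximum (relaxed_values (wave_mat N) T) (gamma_rel (wave_mat N) T)
    \<and> T / (2 * real N) = gamma_rel (wave_mat N) T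
    \<and> (\<forall>b \<in> maximizing_profiles N T. wave_lambda N T b = gamma_rel (wave_mat N) T)
    \<and> (\<forall>b \<in> maximizing_profiles N T. \<forall>j\<in>{1..N}. \<bar>sqrt (real N) * b $ (j - 1)\<bar> = 1)
    \<and> (\<forall>b :: nat \<Rightarrow> real. (\<forall>j\<ge>1. \<bar>b j\<bar> = 1) \<longrightarrow> (\<forall>s. b \<in> H_D_neg s \<longleftrightarrow> s > 1 / 2))"
proof -
  note max_eq = maximizing_profiles_eq[OF assms]
  have "T \<ge> 0" using assms by simp
  note relaxed = relaxed_values_maximum[OF assms(1) this]
  \<comment> \<open>The \<open>GREATEST\<close> operator takes the intended value here because a
    maximum of the relaxed values has been exhibited.\<close>
  have gamma: "gamma_rel (wave_mat N) T = T / (2 * real N)"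
    unfolding gamma_rel_def using relaxed by (intro Greatest_equality) (auto simp: is_maximum_def)
  have signs: "vec N (\<lambda>i. \<epsilon> (i + 1) / sqrt (real N)) \<in> maximizing_profiles N T"
    if "\<forall>j\<in>{1..N}. \<epsilon> j \<in> {-1, 1 :: real}" for \<epsilon>
    using vec_signs_square[OF that] unfolding max_eq by simp
  have "maximizing_profiles N T \<subseteq> unit_profiles N"
    by (auto simp: maximizing_profiles_def is_arg_max_def)
  hence "vec N (\<lambda>i. 1 / sqrt (real N)) \<in> unit_profiles N"
    using signs[of "\<lambda>_. 1"] by auto
  moreover have "wave_lambda N T (vec N (\<lambda>i. 1 / sqrt (real N))) = T / (2 * real N)"
    using signs[of "\<lambda>_. 1"] wave_lambda_equal_moduli[OF assms] unfolding max_eq by simp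
  ultimately have "is_maximum (wave_lambda N T ` unit_profiles N) (T / (2 * real N))"
    unfolding is_maximum_def using wave_lambda_le[OF assms]
    by (auto intro!: image_eqI[of _ _ "vec N (\<lambda>i. 1 / sqrt (real N))"])
  moreover have "wave_lambda N T b = T / (2 * real N)" if "b \<in> maximizing_profiles N T" for b
    using that wave_lambda_equal_moduli[OF assms] unfolding max_eq by simp
  moreover have "\<bar>sqrt (real N) * b $ (j - 1)\<bar> = 1"
    if "b \<in> maximizing_profiles N T" "j \<in> {1..N}" for b j
  proof -
    have "(sqrt (real N) * b $ (j - 1))\<^sup>2 = 1"
      using that assms(1) unfolding max_eq by (simp add: power_mult_distrib)
    thus ?thesis by (simp add: abs_square_eq_1)
  qed
  ultimately show ?thesis
    using max_eq signs relaxed gamma unimodular_in_H_D_neg_iff by auto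
qed

end
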